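(* For every $t\in\mathbb{C}\setminus\{0\}$, every integer $m\ge 0$, and either choice of sign (the same throughout), $$\left.\frac{\partial J_{\nu}(t)}{\partial\nu}\right|_{\nu=\pm m}=(\pm1)^{m}\left[\frac{\pi}{2}Y_{m}(t)\pm\frac{m!}{2}\sum_{k=0}^{m-1}\frac{J_{k}(t)}{k!\,(m-k)}\left(\frac{t}{2}\right)^{k-m}\right].$$
   Context: $J_\nu(t)=\sum_{k=0}^{\infty}\frac{(-1)^k}{k!\,\Gamma(k+\nu+1)}\left(\frac{t}{2}\right)^{2k+\nu}$ is the Bessel function of the first kind (principal branch, $-\pi<\arg t\le\pi$; $1/\Gamma$ is zero at the poles of $\Gamma$), and $Y_\nu(t)=\frac{J_\nu(t)\cos\pi\nu-J_{-\nu}(t)}{\sin\pi\nu}$ (for integer $\nu$, the limit in $\nu$) is the Bessel function of the second kind. Empty sums are $0$. *)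

theory Defs
  imports "HOL-Analysis.Analysis"
begin

text \<open>
  The complex power \<open>powr\<close> uses the principal logarithm \<open>Ln\<close>, with imaginary part in
  \<open>(-\<pi>, \<pi>]\<close>, and \<open>rGamma\<close> is the entire function \<open>1 / \<Gamma>\<close>, which vanishes at the poles
  of \<open>\<Gamma>\<close>. Since \<open>0 powr w = 0\<close> for all \<open>w\<close>, even \<open>w = 0\<close>, the definition is meaningful
  only for \<open>t \<noteq> 0\<close>.
\<close>

definition Bessel_J :: "complex \<Rightarrow> complex \<Rightarrow> complex" where
  "Bessel_J \<nu> t =
     (\<Sum>k. (-1) ^ k / fact k * rGamma (of_nat k + \<nu> + 1) * (t / 2) powr (2 * of_nat k + \<nu>))"

text \<open>
  For integer order the quotient is \<open>0 / 0\<close>; \<open>at \<nu>\<close> is the punctured neighbourhood filter in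
  the complex plane, so the limit is taken over complex non-integer orders.
\<close>

definition Bessel_Y :: "complex \<Rightarrow> complex \<Rightarrow> complex" where
  "Bessel_Y \<nu> t =
     (let Q = (\<lambda>\<mu>. (Bessel_J \<mu> t * cos (of_real pi * \<mu>) - Bessel_J (- \<mu>) t) / sin (of_real pi * \<mu>))
      in if \<nu> \<in> \<int> then Lim (at \<nu>) Q else Q \<nu>)"

end

theory Submission
  imports Defs "HOL-Complex_Analysis.Complex_Analysis"
begin

text \<open>
  Write \<open>D\<close> for the derivative of \<open>J\<^sub>\<nu>(t)\<close> in the order \<open>\<nu>\<close>, and \<open>z = t / 2\<close>. By l'Hospital's rule,
  \<open>\<pi> Y\<^sub>m = D(m) + (-1)\<^sup>m D(-m)\<close>, so both signs of the theorem reduce to a formula for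
  \<open>F\<^sub>m = D(m) - (-1)\<^sup>m D(-m)\<close>. Differentiating \<open>J\<^bsub>\<nu>-1\<^esub> + J\<^bsub>\<nu>+1\<^esub> = (\<nu> / z) J\<^sub>\<nu>\<close> in \<open>\<nu>\<close> gives
  \<open>F\<^bsub>m+1\<^esub> = (m / z) F\<^sub>m - F\<^bsub>m-1\<^esub> + (2 / z) J\<^sub>m\<close>, and the finite sum satisfies the same recurrence with
  the same initial values. No derivative of \<open>\<Gamma>\<close> is needed.
\<close>

section \<open>Convergence of the series and holomorphy in the order\<close>

text \<open>The factor \<open>(t / 2) powr \<nu>\<close> is left out: only natural powers of
  \<open>t / 2\<close> remain, so each term is entire in \<open>\<nu>\<close> and no branch is
  involved.\<close>

definition Bessel_term :: "complex \<Rightarrow> complex \<Rightarrow> nat \<Rightarrow> complex" where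
  "Bessel_term t \<nu> k = (-1) ^ k / fact k * rGamma (of_nat k + \<nu> + 1) * (t / 2) ^ (2 * k)"

text \<open>The functional equation \<open>rGamma w = w * rGamma (w + 1)\<close> shows that a unit
  shift cannot increase the norm once \<open>norm w\<close> is at least 1, as it is for
  \<open>w = k + \<nu> + 1\<close> with \<open>k \<ge> K\<close>.\<close>

lemma norm_rGamma_shift_le:
  assumes "norm \<nu> \<le> real K" and "K \<le> k"
  shows "norm (rGamma (of_nat k + \<nu> + 1 :: complex)) \<le> norm (rGamma (of_nat K + \<nu> + 1))"
  using assms(2)
proof (induction k rule: dec_induct)
  case base
  show ?case by simp
next
  case (step k)
  let ?w = "of_nat k + \<nu> + 1 :: complex"
  have "1 \<le> real (k + 1) - norm \<nu>"
    using assms(1) step.hyps by linarith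
  also have "\<dots> = norm (of_nat (k + 1) :: complex) - norm (- \<nu>)"
    by (simp only: norm_of_nat norm_minus_cancel)
  also have "\<dots> \<le> norm (of_nat (k + 1) - (- \<nu>))"
    by (rule norm_triangle_ineq2)
  also have "of_nat (k + 1) - (- \<nu>) = ?w"
    by simp
  finally have "1 \<le> norm ?w" .
  hence "norm (rGamma (?w + 1)) \<le> norm ?w * norm (rGamma (?w + 1))"
    using mult_right_mono[of 1 "norm ?w" "norm (rGamma (?w + 1))"] by simp
  also have "\<dots> = norm (rGamma ?w)"
    by (simp only: norm_mult[symmetric] rGamma_plus1)
  also note step.IH
  finally show ?case by (simp add: add_ac)
qed

text \<open>A majorant for the Weierstrass M-test on a disc of orders: for \<open>k \<ge> K\<close>
  the \<open>rGamma\<close> factor is at most its bound \<open>C\<close> at index \<open>K\<close>,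
  which exists by compactness, and the rest is an exponential series.\<close>

lemma Bessel_term_bound:
  obtains B where "summable B"
    and "\<forall>\<^sub>F k in sequentially. \<forall>\<nu>\<in>cball 0 R. norm (Bessel_term t \<nu> k) \<le> B k"
proof -
  obtain K :: nat where K: "R \<le> real K"
    using real_arch_simple by blast
  have "continuous_on (cball 0 R) (\<lambda>\<nu>::complex. rGamma (of_nat K + \<nu> + 1))"
    by (intro holomorphic_on_imp_continuous_on holomorphic_intros)
  hence "compact ((\<lambda>\<nu>::complex. rGamma (of_nat K + \<nu> + 1)) ` cball 0 R)"
    by (intro compact_continuous_image) auto
  then obtain C where C: "\<And>\<nu>::complex. \<nu> \<in> cball 0 R \<Longrightarrow> norm (rGamma (of_nat K + \<nu> + 1)) \<le> C"
    by (meson compact_imp_bounded bounded_iff imageI)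
  define B where "B k = C * (((norm (t / 2))\<^sup>2) ^ k /\<^sub>R fact k)" for k
  have "summable B"
    unfolding B_def by (intro summable_mult summable_exp_generic)
  moreover have "\<forall>\<^sub>F k in sequentially. \<forall>\<nu>\<in>cball 0 R. norm (Bessel_term t \<nu> k) \<le> B k"
    using eventually_ge_at_top[of K]
  proof eventually_elim
    case (elim k)
    show ?case
    proof
      fix \<nu> :: complex assume \<nu>: "\<nu> \<in> cball 0 R"
      have "norm (Bessel_term t \<nu> k)
          = norm (rGamma (of_nat k + \<nu> + 1)) * (((norm (t / 2))\<^sup>2) ^ k /\<^sub>R fact k)"
        by (simp add: Bessel_term_def norm_mult norm_divide norm_power power_mult)
           (simp add: field_simps)
      also have "norm (rGamma (of_nat k + \<nu> + 1)) \<le> norm (rGamma (of_nat K + \<nu> + 1))"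
        using K \<nu> elim by (intro norm_rGamma_shift_le) auto
      also have "\<dots> \<le> C" by (rule C[OF \<nu>])
      finally show "norm (Bessel_term t \<nu> k) \<le> B k"
        by (simp add: B_def mult_right_mono)
    qed
  qed
  ultimately show ?thesis by (rule that)
qed

lemma summable_Bessel_term: "summable (Bessel_term t \<nu>)"
proof -
  obtain B where B: "summable B"
    "\<forall>\<^sub>F k in sequentially. \<forall>\<mu>\<in>cball 0 (norm \<nu>). norm (Bessel_term t \<mu> k) \<le> B k"
    by (rule Bessel_term_bound)
  show ?thesis
    by (rule summable_comparison_test_ev[OF _ B(1)], use B(2) in eventually_elim) auto
qed

lemma holomorphic_suminf_Bessel_term: "(\<lambda>\<nu>. suminf (Bessel_term t \<nu>)) holomorphic_on UNIV"
proof (rule holomorphic_uniform_sequence[where f = "\<lambda>n \<nu>. \<Sum>k<n. Bessel_term t \<nu> k"])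
  show "(\<lambda>\<nu>. \<Sum>k<n. Bessel_term t \<nu> k) holomorphic_on UNIV" for n
    unfolding Bessel_term_def by (intro holomorphic_intros)
next
  fix \<nu> :: complex
  obtain B where B: "summable B"
    "\<forall>\<^sub>F k in sequentially. \<forall>\<mu>\<in>cball 0 (norm \<nu> + 1). norm (Bessel_term t \<mu> k) \<le> B k"
    by (rule Bessel_term_bound)
  have "uniform_limit (cball 0 (norm \<nu> + 1)) (\<lambda>n \<mu>. \<Sum>k<n. Bessel_term t \<mu> k)
          (\<lambda>\<mu>. suminf (Bessel_term t \<mu>)) sequentially"
    by (rule Weierstrass_m_test_ev[OF B(2,1)])
  moreover have "cball \<nu> 1 \<subseteq> cball 0 (norm \<nu> + 1)"
    by (simp add: cball_subset_cball_iff)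
  ultimately show "\<exists>d>0. cball \<nu> d \<subseteq> UNIV \<and>
      uniform_limit (cball \<nu> d) (\<lambda>n \<mu>. \<Sum>k<n. Bessel_term t \<mu> k)
        (\<lambda>\<mu>. suminf (Bessel_term t \<mu>)) sequentially"
    by (intro exI[of _ 1]) (auto intro: uniform_limit_on_subset)
qed auto

lemma Bessel_J_eq:
  assumes "t \<noteq> 0"
  shows "Bessel_J \<nu> t = (t / 2) powr \<nu> * suminf (Bessel_term t \<nu>)"
proof -
  have "(t / 2) powr (2 * of_nat k + \<nu>) = (t / 2) powr \<nu> * (t / 2) ^ (2 * k)" for k
    using assms powr_nat[of "t / 2" "2 * k"] by (simp add: powr_add mult.commute)
  hence "Bessel_J \<nu> t = (\<Sum>k. (t / 2) powr \<nu> * Bessel_term t \<nu> k)"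
    unfolding Bessel_J_def Bessel_term_def by (simp add: mult_ac)
  thus ?thesis
    by (simp add: suminf_mult[OF summable_Bessel_term])
qed

lemma has_field_derivative_Bessel_J:
  assumes "t \<noteq> 0"
  shows "((\<lambda>\<nu>. Bessel_J \<nu> t) has_field_derivative deriv (\<lambda>\<nu>. Bessel_J \<nu> t) \<nu>) (at \<nu>)"
proof -
  have "(\<lambda>\<nu>. Bessel_J \<nu> t) holomorphic_on UNIV"
    unfolding Bessel_J_eq[OF assms] using assms
    by (intro holomorphic_intros holomorphic_suminf_Bessel_term)
  thus ?thesis
    by (rule holomorphic_derivI) auto
qed

section \<open>Three-term recurrences and integer orders\<close>

text \<open>Termwise, lowering the order multiplies the coefficient by \<open>k + \<nu>\<close>,
  while raising it and shifting the index contributes the factor \<open>- k\<close>; the sum leaves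
  \<open>\<nu>\<close>. With \<open>rGamma\<close> this holds at every order, integers
  included.\<close>

lemma Bessel_J_recurrence:
  assumes "t \<noteq> 0"
  shows "Bessel_J (\<nu> - 1) t + Bessel_J (\<nu> + 1) t = \<nu> / (t / 2) * Bessel_J \<nu> t"
proof -
  define z where "z = t / 2"
  have z: "z \<noteq> 0" using assms by (simp add: z_def)
  let ?c = "Bessel_term t"
  have down: "?c (\<nu> - 1) k = (of_nat k + \<nu>) * ?c \<nu> k" for k
    using rGamma_plus1[of "of_nat k + \<nu>"] by (simp add: Bessel_term_def mult_ac)
  have up: "z\<^sup>2 * ?c (\<nu> + 1) k = - (of_nat (Suc k) * ?c \<nu> (Suc k))" for k
    by (simp add: Bessel_term_def z_def field_simps power2_eq_square del: of_nat_Suc)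
       (simp add: algebra_simps)
  have "(\<lambda>k. - (of_nat (Suc k) * ?c \<nu> (Suc k))) sums (z\<^sup>2 * suminf (?c (\<nu> + 1)))"
    unfolding up[symmetric] by (intro sums_mult summable_sums summable_Bessel_term)
  \<comment> \<open>The index shift adds a term at \<open>k = 0\<close>, which the factor
    \<open>of_nat k\<close> kills.\<close>
  hence "(\<lambda>k. - (of_nat k * ?c \<nu> k)) sums (z\<^sup>2 * suminf (?c (\<nu> + 1)))"
    by (subst (asm) sums_Suc_iff) simp
  moreover have "(\<lambda>k. (of_nat k + \<nu>) * ?c \<nu> k) sums suminf (?c (\<nu> - 1))"
    unfolding down[symmetric] by (intro summable_sums summable_Bessel_term)
  ultimately have "(\<lambda>k. (of_nat k + \<nu>) * ?c \<nu> k + - (of_nat k * ?c \<nu> k)) sums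
      (suminf (?c (\<nu> - 1)) + z\<^sup>2 * suminf (?c (\<nu> + 1)))"
    by (rule sums_add[rotated])
  hence "(\<lambda>k. \<nu> * ?c \<nu> k) sums (suminf (?c (\<nu> - 1)) + z\<^sup>2 * suminf (?c (\<nu> + 1)))"
    by (simp add: algebra_simps)
  moreover have "(\<lambda>k. \<nu> * ?c \<nu> k) sums (\<nu> * suminf (?c \<nu>))"
    by (intro sums_mult summable_sums summable_Bessel_term)
  ultimately have eq: "suminf (?c (\<nu> - 1)) + z\<^sup>2 * suminf (?c (\<nu> + 1)) = \<nu> * suminf (?c \<nu>)"
    by (rule sums_unique2)
  have p: "z powr (\<nu> - 1) = z powr \<nu> / z" "z powr (\<nu> + 1) = z powr \<nu> * z"
    using z by (simp_all add: powr_diff powr_add)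
  have "Bessel_J (\<nu> - 1) t + Bessel_J (\<nu> + 1) t =
      z powr \<nu> / z * (suminf (?c (\<nu> - 1)) + z\<^sup>2 * suminf (?c (\<nu> + 1)))"
    unfolding Bessel_J_eq[OF assms] z_def[symmetric] p using z
    by (simp add: field_simps power2_eq_square)
  also have "\<dots> = \<nu> / z * Bessel_J \<nu> t"
    unfolding eq Bessel_J_eq[OF assms] z_def[symmetric] by simp
  finally show ?thesis by (simp add: z_def)
qed

text \<open>At order 0 the right side of the recurrence vanishes, which gives the case 1. Beyond
  that, the recurrences at \<open>n + 1\<close> and \<open>- (n + 1)\<close> agree up to alternating
  signs.\<close>

lemma Bessel_J_minus_of_nat:
  assumes "t \<noteq> 0"
  shows "Bessel_J (- of_nat m) t = (-1) ^ m * Bessel_J (of_nat m) t"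
proof (induction m rule: induct_nat_012)
  case 0
  show ?case by simp
next
  case 1
  show ?case using Bessel_J_recurrence[OF assms, of 0] by (simp add: add_eq_0_iff)
next
  case (ge2 n)
  have up: "Bessel_J (of_nat (Suc (Suc n))) t
      = of_nat (Suc n) / (t / 2) * Bessel_J (of_nat (Suc n)) t - Bessel_J (of_nat n) t"
    using Bessel_J_recurrence[OF assms, of "of_nat (Suc n)"] by (simp add: add_ac eq_diff_eq)
  have down: "Bessel_J (- of_nat (Suc (Suc n))) t
      = - of_nat (Suc n) / (t / 2) * Bessel_J (- of_nat (Suc n)) t - Bessel_J (- of_nat n) t"
    using Bessel_J_recurrence[OF assms, of "- of_nat (Suc n)"] by (simp add: add_ac eq_diff_eq)
  show ?case
    unfolding down up ge2 by (simp add: algebra_simps del: of_nat_Suc)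
qed

lemma deriv_Bessel_J_recurrence:
  fixes t
  defines "D \<equiv> deriv (\<lambda>\<nu>. Bessel_J \<nu> t)"
  assumes "t \<noteq> 0"
  shows "D (\<nu> - 1) + D (\<nu> + 1) = \<nu> / (t / 2) * D \<nu> + Bessel_J \<nu> t / (t / 2)"
proof -
  note DJ [derivative_intros] =
    DERIV_chain2[OF has_field_derivative_Bessel_J[OF assms(2), folded D_def]]
  have "((\<lambda>\<nu>. Bessel_J (\<nu> - 1) t + Bessel_J (\<nu> + 1) t) has_field_derivative
      D (\<nu> - 1) + D (\<nu> + 1)) (at \<nu>)"
    by (auto intro!: derivative_eq_intros)
  moreover have "((\<lambda>\<nu>. \<nu> / (t / 2) * Bessel_J \<nu> t) has_field_derivative
      \<nu> / (t / 2) * D \<nu> + Bessel_J \<nu> t / (t / 2)) (at \<nu>)"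
    using assms(2) by (auto intro!: derivative_eq_intros simp: field_simps)
  ultimately show ?thesis
    unfolding Bessel_J_recurrence[OF assms(2)] by (rule DERIV_unique)
qed

section \<open>The second kind at integer order\<close>

lemma Bessel_Y_of_nat:
  assumes "t \<noteq> 0"
  shows "of_real pi * Bessel_Y (of_nat m) t =
    deriv (\<lambda>\<nu>. Bessel_J \<nu> t) (of_nat m) + (-1) ^ m * deriv (\<lambda>\<nu>. Bessel_J \<nu> t) (- of_nat m)"
proof -
  define D where "D = deriv (\<lambda>\<nu>. Bessel_J \<nu> t)"
  note DJ [derivative_intros] =
    DERIV_chain2[OF has_field_derivative_Bessel_J[OF assms, folded D_def]]
  let ?N = "\<lambda>\<mu>. Bessel_J \<mu> t * cos (of_real pi * \<mu>) - Bessel_J (- \<mu>) t"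
  have cos_m: "cos (of_real pi * of_nat m :: complex) = (-1) ^ m"
    using cos_of_real[of "real m * pi", where 'a = complex] by (simp add: mult.commute)
  have sin_m: "sin (of_real pi * of_nat m :: complex) = 0"
    using sin_of_real[of "real m * pi", where 'a = complex] by (simp add: mult.commute)
  have "((\<lambda>\<mu>. ?N \<mu> / sin (of_real pi * \<mu>)) \<longlongrightarrow>
      (D (of_nat m) + (-1) ^ m * D (- of_nat m)) / of_real pi) (at (of_nat m))"
  proof (rule lhopital_complex_simple)
    \<comment> \<open>The derivative of the cosine drops out because
      \<open>sin (pi * m) = 0\<close>, and the two minus signs before \<open>D (- of_nat m)\<close>
      cancel.\<close>
    show "(?N has_field_derivative D (of_nat m) * (-1) ^ m + D (- of_nat m)) (at (of_nat m))"
      by (auto intro!: derivative_eq_intros simp: cos_m sin_m)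
    show "((\<lambda>\<mu>::complex. sin (of_real pi * \<mu>)) has_field_derivative of_real pi * (-1) ^ m)
            (at (of_nat m))"
      by (auto intro!: derivative_eq_intros simp: cos_m)
    show "?N (of_nat m) = 0"
      by (simp add: cos_m Bessel_J_minus_of_nat[OF assms])
    show "(D (of_nat m) * (-1) ^ m + D (- of_nat m)) / (of_real pi * (-1) ^ m)
        = (D (of_nat m) + (-1) ^ m * D (- of_nat m)) / of_real pi"
      by (cases "even m") (auto simp: field_simps)
  qed (simp_all add: sin_m)
  from tendsto_Lim[OF _ this] show ?thesis
    unfolding Bessel_Y_def Let_def D_def by simp
qed

section \<open>The finite sum and the reflection formula\<close>

text \<open>
  The hypothesis on \<open>b\<close> is the three-term recurrence of \<open>J\<^sub>k(t) z\<^sup>k\<close>, with \<open>x = z\<^sup>2\<close>. Used to eliminate \<open>x\<close>,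
  it makes the coefficients of all \<open>b k\<close> with \<open>k \<le> n\<close> cancel.
\<close>

lemma sum_recurrence:
  fixes b :: "nat \<Rightarrow> complex"
  assumes b: "\<And>k. x * b k = of_nat (Suc k) * b (Suc k) - b (Suc (Suc k))"
  defines "S \<equiv> \<lambda>m. \<Sum>k<m. b k / (fact k * (of_nat m - of_nat k))"
  shows "of_nat (Suc n) * of_nat (Suc (Suc n)) * S (Suc (Suc n)) - (of_nat (Suc n))\<^sup>2 * S (Suc n)
    + x * S n = 2 * of_nat (Suc n) * b (Suc n) / fact (Suc n)"
proof -
  define m :: complex where "m = of_nat (Suc n)"
  \<comment> \<open>\<open>f\<close> and \<open>g\<close> are the two parts of
    \<open>x * S n\<close> after \<open>b\<close> is substituted, reindexed by \<open>k + 1\<close>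
    and \<open>k + 2\<close>. Their numerators absorb the change of factorial and make the added
    terms \<open>f 0\<close>, \<open>g 0\<close> and \<open>g 1\<close> vanish.\<close>
  define f where "f k = (of_nat k)\<^sup>2 * b k / (fact k * (m - of_nat k))" for k
  define g where "g k = of_nat k * (of_nat k - 1) * b k / (fact k * (m + 1 - of_nat k))" for k
  have f_Suc: "f (Suc k) = of_nat (Suc k) * b (Suc k) / (fact k * (of_nat n - of_nat k))" for k
    unfolding f_def m_def by (simp add: power2_eq_square del: of_nat_Suc) (simp add: field_simps)
  have g_Suc: "g (Suc (Suc k)) = b (Suc (Suc k)) / (fact k * (of_nat n - of_nat k))" for k
  proof -
    have "(of_nat (Suc (Suc k)) :: complex) - 1 = of_nat (Suc k)"
      "m + 1 - of_nat (Suc (Suc k)) = of_nat n - of_nat k"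
      by (simp_all add: m_def)
    thus ?thesis
      unfolding g_def by (simp del: of_nat_Suc)
  qed
  have "x * S n = (\<Sum>k<n. f (Suc k) - g (Suc (Suc k)))"
    unfolding S_def sum_distrib_left
    by (intro sum.cong refl, simp only: f_Suc g_Suc times_divide_eq_right b diff_divide_distrib)
  also have "\<dots> = (\<Sum>k<Suc n. f k) - (\<Sum>k<Suc (Suc n). g k)"
    by (simp only: sum_subtractf sum.lessThan_Suc_shift) (simp add: f_def g_def)
  also have "\<dots> = (\<Sum>k<Suc n. f k - g k) - g (Suc n)"
    by (simp add: sum_subtractf)
  \<comment> \<open>Division with remainder: \<open>k^2 / (m - k) = m^2 / (m - k) - (m + k)\<close>
    and \<open>k * (k - 1) / (m + 1 - k) = m * (m + 1) / (m + 1 - k) - (m + k)\<close>. The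
    remainders \<open>m + k\<close> are equal and cancel.\<close>
  also have "(\<Sum>k<Suc n. f k - g k) =
      (\<Sum>k<Suc n. m\<^sup>2 * (b k / (fact k * (m - of_nat k)))
                  - m * (m + 1) * (b k / (fact k * (m + 1 - of_nat k))))"
  proof (intro sum.cong refl)
    fix k assume "k \<in> {..<Suc n}"
    hence "m - of_nat k \<noteq> 0" "m + 1 - of_nat k \<noteq> 0"
      using of_nat_eq_iff[of "Suc n" k, where 'a = complex]
        of_nat_eq_iff[of "Suc (Suc n)" k, where 'a = complex] by (auto simp: m_def add_ac)
    thus "f k - g k = m\<^sup>2 * (b k / (fact k * (m - of_nat k)))
                  - m * (m + 1) * (b k / (fact k * (m + 1 - of_nat k)))"
      unfolding f_def g_def
      by (simp add: divide_simps) (simp add: algebra_simps power2_eq_square)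
  qed
  \<comment> \<open>\<open>S (Suc (Suc n))\<close> has one more term, at \<open>k = n + 1\<close>,
    where the linear denominator is 1.\<close>
  also have "\<dots> = m\<^sup>2 * S (Suc n) - m * (m + 1) * (S (Suc (Suc n)) - b (Suc n) / fact (Suc n))"
  proof -
    have "S (Suc n) = (\<Sum>k<Suc n. b k / (fact k * (m - of_nat k)))"
      by (simp only: S_def m_def)
    moreover have "S (Suc (Suc n)) =
        (\<Sum>k<Suc n. b k / (fact k * (m + 1 - of_nat k))) + b (Suc n) / fact (Suc n)"
      unfolding S_def sum.lessThan_Suc[of _ "Suc n"] by (simp only: m_def of_nat_Suc) simp
    ultimately show ?thesis
      by (simp only: sum_subtractf sum_distrib_left add_diff_cancel_right')
  qed
  finally have "x * S n = m\<^sup>2 * S (Suc n)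
      - m * (m + 1) * (S (Suc (Suc n)) - b (Suc n) / fact (Suc n)) - g (Suc n)" .
  \<comment> \<open>The boundary terms combine by \<open>m * (m + 1) - m * (m - 1) = 2 * m\<close>
    into the right side of the claim.\<close>
  moreover have "g (Suc n) = m * (m - 1) * b (Suc n) / fact (Suc n)"
    by (simp add: g_def m_def del: fact_Suc)
  moreover have "of_nat (Suc (Suc n)) = m + 1"
    by (simp add: m_def)
  ultimately show ?thesis
    unfolding m_def[symmetric]
    by (simp add: divide_simps del: fact_Suc) (simp add: algebra_simps power2_eq_square)
qed

lemma deriv_Bessel_J_reflection:
  fixes t
  defines "D \<equiv> deriv (\<lambda>\<nu>. Bessel_J \<nu> t)"
  assumes "t \<noteq> 0"
  shows "D (of_nat m) - (-1) ^ m * D (- of_nat m) = fact m / (t / 2) ^ m *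
    (\<Sum>k<m. Bessel_J (of_nat k) t * (t / 2) ^ k / (fact k * (of_nat m - of_nat k)))"
proof -
  define z where "z = t / 2"
  have z: "z \<noteq> 0" using assms by (simp add: z_def)
  define b where "b k = Bessel_J (of_nat k) t * z ^ k" for k
  define S where "S m = (\<Sum>k<m. b k / (fact k * (of_nat m - of_nat k)))" for m
  note J = Bessel_J_recurrence[OF assms(2), folded z_def]
  note D = deriv_Bessel_J_recurrence[OF assms(2), folded D_def z_def]
  have b: "z\<^sup>2 * b k = of_nat (Suc k) * b (Suc k) - b (Suc (Suc k))" for k
  proof -
    have "z\<^sup>2 * b k + b (Suc (Suc k))
        = z ^ Suc (Suc k) * (Bessel_J (of_nat (Suc k) - 1) t + Bessel_J (of_nat (Suc k) + 1) t)"
      by (simp add: b_def algebra_simps power2_eq_square)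
    also have "\<dots> = of_nat (Suc k) * b (Suc k)"
      unfolding J using z by (simp add: b_def del: of_nat_Suc)
    finally show ?thesis by (simp add: eq_diff_eq)
  qed
  note S = sum_recurrence[OF b, folded S_def]
  have "D (of_nat m) - (-1) ^ m * D (- of_nat m) = fact m / z ^ m * S m"
  proof (induction m rule: induct_nat_012)
    case 0
    show ?case by (simp add: S_def)
  next
    case 1
    \<comment> \<open>At order 0 the differentiated recurrence reads
      \<open>D (-1) + D 1 = J_0 / z\<close>.\<close>
    show ?case using D[of 0] z by (simp add: S_def b_def add.commute)
  next
    case (ge2 n)
    let ?m = "of_nat (Suc n) :: complex"
    have up: "D (of_nat (Suc (Suc n))) = ?m / z * D ?m + Bessel_J ?m t / z - D (of_nat n)"
      using D[of ?m] by (simp add: add_ac eq_diff_eq)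
    have down: "D (- of_nat (Suc (Suc n)))
        = - ?m / z * D (- ?m) + (-1) ^ Suc n * Bessel_J ?m t / z - D (- of_nat n)"
      using D[of "- ?m"] unfolding Bessel_J_minus_of_nat[OF assms(2)]
      by (simp add: add_ac eq_diff_eq)
    have "D (of_nat (Suc (Suc n))) - (-1) ^ Suc (Suc n) * D (- of_nat (Suc (Suc n)))
        = ?m / z * (D ?m - (-1) ^ Suc n * D (- ?m)) - (D (of_nat n) - (-1) ^ n * D (- of_nat n))
          + 2 * Bessel_J ?m t / z"
      unfolding up down by (cases "even n") (simp_all add: algebra_simps del: of_nat_Suc)
    also have "\<dots> = ?m / z * (fact (Suc n) / z ^ Suc n * S (Suc n)) - fact n / z ^ n * S n
          + 2 * Bessel_J ?m t / z"
      unfolding ge2 by (rule refl)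
    also have "\<dots> = fact (Suc (Suc n)) / z ^ Suc (Suc n) * S (Suc (Suc n))"
    proof -
      have m: "?m \<noteq> 0" by (simp del: of_nat_Suc)
      \<comment> \<open>Taking out \<open>fact n / z ^ (n + 2)\<close> exposes the combination that
        \<open>sum_recurrence\<close> evaluates at \<open>x = z^2\<close>.\<close>
      have "?m / z * (fact (Suc n) / z ^ Suc n * S (Suc n)) - fact n / z ^ n * S n
          + 2 * Bessel_J ?m t / z
        = fact n / z ^ Suc (Suc n) * (?m\<^sup>2 * S (Suc n) - z\<^sup>2 * S n + 2 * ?m * b (Suc n) / fact (Suc n))"
        using z m unfolding b_def fact_Suc
        by (simp add: field_simps power2_eq_square del: of_nat_Suc)
      also have "?m\<^sup>2 * S (Suc n) - z\<^sup>2 * S n + 2 * ?m * b (Suc n) / fact (Suc n)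
        = ?m * of_nat (Suc (Suc n)) * S (Suc (Suc n))"
        unfolding S[of n, symmetric] by simp
      finally show ?thesis
        by (simp add: mult_ac del: of_nat_Suc)
    qed
    finally show ?case .
  qed
  thus ?thesis
    by (simp add: S_def b_def z_def)
qed

theorem corollary3p2:
  fixes t s :: complex and m :: nat
  assumes "t \<noteq> 0" and "s = 1 \<or> s = -1"
  shows "((\<lambda>\<nu>. Bessel_J \<nu> t) has_field_derivative
            s ^ m * (of_real pi / 2 * Bessel_Y (of_nat m) t
                     + s * (fact m / 2 * (\<Sum>k<m. Bessel_J (of_nat k) t / (fact k * (of_nat m - of_nat k))
                                               * (t / 2) powi (int k - int m)))))
         (at (s * of_nat m))"
proof -
  define z where "z = t / 2"
  have z: "z \<noteq> 0" using assms by (simp add: z_def)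
  define D where "D = deriv (\<lambda>\<nu>. Bessel_J \<nu> t)"
  define S where "S = fact m * (\<Sum>k<m. Bessel_J (of_nat k) t / (fact k * (of_nat m - of_nat k))
                                     * z powi (int k - int m))"
  have "S = fact m / z ^ m * (\<Sum>k<m. Bessel_J (of_nat k) t * z ^ k / (fact k * (of_nat m - of_nat k)))"
    unfolding S_def sum_distrib_left using z
    by (intro sum.cong refl) (simp add: power_int_diff)
  hence diff: "D (of_nat m) - (-1) ^ m * D (- of_nat m) = S"
    using deriv_Bessel_J_reflection[OF assms(1), folded D_def z_def] by simp
  \<comment> \<open>Sum and difference of \<open>D (of_nat m)\<close> and
    \<open>(-1) ^ m * D (- of_nat m)\<close> give twice the first for \<open>s = 1\<close> and twice
    the second for \<open>s = -1\<close>, where \<open>s ^ m\<close> removes the sign.\<close>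
  have "s ^ m * (of_real pi * Bessel_Y (of_nat m) t + s * S) / 2 = D (s * of_nat m)"
    unfolding diff[symmetric] Bessel_Y_of_nat[OF assms(1), folded D_def]
    using assms(2) by (cases "even m") auto
  also have "s ^ m * (of_real pi * Bessel_Y (of_nat m) t + s * S) / 2
      = s ^ m * (of_real pi / 2 * Bessel_Y (of_nat m) t
          + s * (fact m / 2 * (\<Sum>k<m. Bessel_J (of_nat k) t / (fact k * (of_nat m - of_nat k))
                                     * (t / 2) powi (int k - int m))))"
    by (simp add: S_def z_def algebra_simps add_divide_distrib)
  finally show ?thesis
    using has_field_derivative_Bessel_J[OF assms(1), of "s * of_nat m"] by (simp add: D_def)
qed

end
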